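(* Let $C\ge 1$ be any fixed approximation factor. Any algorithm that, given query access to a graph $G$ on $n$ vertices, outputs with high constant probability an estimate $\widehat{t}$ with $t(G)/C\le \widehat{t}\le C\cdot t(G)$ (where $t(G)$ is the number of triangles of $G$) must perform $\Omega\!\left(\frac{n}{t(G)^{1/3}}\right)$ queries, where the allowed queries are degree queries, pair queries and random new-neighbor queries.
   Context: Queries: a degree query on vertex $v$ returns its degree; a pair query on $(u,v)$ returns whether $(u,v)$ is an edge; a random new-neighbor query on vertex $u$ returns a vertex $v$ such that $(u,v)$ is an edge, where the edge $(u,v)$ is chosen uniformly at random among the edges incident to $u$ that have not yet been observed by the algorithm. The algorithm may also sample vertices uniformly at random. The lower bound is meant in the sense that for every $n$ and every $1\le t\le\binom{n}{3}$ there are $n$-vertex graphs with $0$ triangles and with $\Theta(t)$ triangles that cannot be distinguished with high constant probability using $o(n/t^{1/3})$ queries. *)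

theory Defs
  imports "HOL-Probability.Probability" "HOL-Combinatorics.Permutations"
begin

text \<open>A graph on \<open>n\<close> vertices has vertex set \<open>{..<n}\<close> and is given by its set of edges.\<close>

definition simple_graph :: "nat \<Rightarrow> nat set set \<Rightarrow> bool" where
  "simple_graph n E \<longleftrightarrow> E \<subseteq> {e. e \<subseteq> {..<n} \<and> card e = 2}"

definition degree :: "nat set set \<Rightarrow> nat \<Rightarrow> nat" where
  "degree E u = card {e \<in> E. u \<in> e}"

definition num_triangles :: "nat set set \<Rightarrow> nat" where
  "num_triangles E = card {T. card T = 3 \<and> (\<forall>u\<in>T. \<forall>v\<in>T. u \<noteq> v \<longrightarrow> {u, v} \<in> E)}"

definition copies :: "nat \<Rightarrow> nat set set \<Rightarrow> nat set set set" where
  "copies n E = {(\<lambda>e. \<pi> ` e) ` E | \<pi>. \<pi> permutes {..<n}}"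

datatype query = Degree nat | Pair nat nat | Neighbor nat | Sample

datatype answer = Count nat | Adjacent bool | Vertex "nat option"

type_synonym transcript = "(query \<times> answer) list"

definition observed :: "transcript \<Rightarrow> nat set set" where
  "observed h = {{u, v} | u v. (Pair u v, Adjacent True) \<in> set h \<or>
                              (Neighbor u, Vertex (Some v)) \<in> set h}"

definition new_neighbors :: "nat set set \<Rightarrow> transcript \<Rightarrow> nat \<Rightarrow> nat set" where
  "new_neighbors E h u = {v. {u, v} \<in> E - observed h}"

text \<open>
  The answer to a query, given the transcript so far. A new-neighbor query is answered by
  \<open>None\<close> when all edges at the vertex have been observed.  Queries naming a number \<open>\<ge> n\<close>
  are answered as if it were an isolated vertex, so they carry no information.
\<close>

fun answer_pmf :: "nat \<Rightarrow> nat set set \<Rightarrow> transcript \<Rightarrow> query \<Rightarrow> answer pmf" where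
  "answer_pmf n E h (Degree u) = return_pmf (Count (degree E u))"
| "answer_pmf n E h (Pair u v) = return_pmf (Adjacent ({u, v} \<in> E))"
| "answer_pmf n E h (Neighbor u) =
     (if new_neighbors E h u = {} then return_pmf (Vertex None)
      else map_pmf (\<lambda>v. Vertex (Some v)) (pmf_of_set (new_neighbors E h u)))"
| "answer_pmf n E h Sample = map_pmf (\<lambda>v. Vertex (Some v)) (pmf_of_set {..<n})"

text \<open>
  An adaptive randomized algorithm is given by the conditional distribution of its next action
  given the transcript; its internal coins are averaged out in this distribution.  There is no
  computability restriction, and an algorithm need not halt.
\<close>

datatype 'r action = Ask query | Output 'r

type_synonym 'r algorithm = "transcript \<Rightarrow> 'r action pmf"

text \<open>
  The first \<open>k\<close> steps of an execution continuing from transcript \<open>h\<close>: the resulting transcript,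
  and the output if the algorithm has halted.
\<close>

primrec run :: "nat \<Rightarrow> nat set set \<Rightarrow> 'r algorithm \<Rightarrow> nat \<Rightarrow> transcript
                  \<Rightarrow> (transcript \<times> 'r option) pmf" where
  "run n E A 0 h = return_pmf (h, None)"
| "run n E A (Suc k) h = bind_pmf (A h) (\<lambda>a. case a of
       Output r \<Rightarrow> return_pmf (h, Some r)
     | Ask q \<Rightarrow> bind_pmf (answer_pmf n E h q) (\<lambda>x. run n E A k (h @ [(q, x)])))"

text \<open>The probability of ever halting with an output in \<open>R\<close>.\<close>

definition output_prob :: "nat \<Rightarrow> nat set set \<Rightarrow> 'r algorithm \<Rightarrow> 'r set \<Rightarrow> real" where
  "output_prob n E A R =
     (SUP k. measure_pmf.prob (run n E A k []) {(h, x). x \<in> Some ` R})"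

text \<open>Vertex samples are free of charge.\<close>

definition num_queries :: "transcript \<Rightarrow> nat" where
  "num_queries h = length (filter (\<lambda>(q, x). q \<noteq> Sample) h)"

text \<open>
  The expectation over complete executions, as the limit of the nondecreasing expectations over
  the first \<open>k\<close> steps; it may be infinite.
\<close>

definition expected_queries :: "nat \<Rightarrow> nat set set \<Rightarrow> 'r algorithm \<Rightarrow> ennreal" where
  "expected_queries n E A =
     (SUP k. \<integral>\<^sup>+ z. of_nat (num_queries (fst z)) \<partial>measure_pmf (run n E A k []))"

definition approximates_triangles :: "nat \<Rightarrow> real \<Rightarrow> real \<Rightarrow> real algorithm \<Rightarrow> bool" where
  "approximates_triangles n C p A \<longleftrightarrow> (\<forall>E. simple_graph n E \<longrightarrow>
     output_prob n E A {real (num_triangles E) / C .. C * real (num_triangles E)} \<ge> p)"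

text \<open>
  An algorithm that knew the vertex labels could tell two fixed graphs apart without effort, so
  distinguishing two graphs means distinguishing them under all labelings by \<open>{..<n}\<close>.
\<close>

definition distinguishes ::
    "nat \<Rightarrow> real \<Rightarrow> bool algorithm \<Rightarrow> nat set set \<Rightarrow> nat set set \<Rightarrow> bool" where
  "distinguishes n p A E0 E1 \<longleftrightarrow>
     (\<forall>E \<in> copies n E0. output_prob n E A {False} \<ge> p) \<and>
     (\<forall>E \<in> copies n E1. output_prob n E A {True} \<ge> p)"

end

theory Submission imports Defs begin

text \<open>
  The empty graph is to be told apart from a clique on \<open>k\<close> of the \<open>n\<close> vertices, where
  \<open>k\<close> is of order \<open>t\<^sup>1\<^sup>/\<^sup>3\<close>.  Each query names a vertex \<open>u\<close> such that it is answered as in the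
  empty graph unless \<open>u\<close> lies in the clique.  Under the \<open>n\<close> cyclic shifts of the clique, a given
  vertex is hit by only \<open>k\<close> of them, so a transcript on the empty graph with at most \<open>q\<close> queries
  is equally likely on all but \<open>q k\<close> of the shifts.  An algorithm with expected query number well
  below \<open>n/k\<close> on all shifts may be stopped after \<open>q = \<delta> n/k\<close> queries, giving the answer for the
  empty graph: by Markov's inequality this costs little on the shifts, and nothing on the empty
  graph, where no assumption on the number of queries is needed.
\<close>

section \<open>Cliques and the queries that cannot see them\<close>

definition clique :: "nat set \<Rightarrow> nat set set" where
  "clique S = {e. e \<subseteq> S \<and> card e = 2}"

text \<open>One vertex per charged query is enough: a pair can be an edge of a clique only if both
  endpoints lie in it, so a first endpoint outside already forces the answer \<open>False\<close>.
  Samples are answered independently of the edges.\<close>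

fun probe :: "query \<Rightarrow> nat set" where
  "probe (Degree u) = {u}"
| "probe (Pair u v) = {u}"
| "probe (Neighbor u) = {u}"
| "probe Sample = {}"

definition probed :: "transcript \<Rightarrow> nat set" where
  "probed h = (\<Union>(q, x)\<in>set h. probe q)"

lemma card_probed_le: "finite (probed h) \<and> card (probed h) \<le> num_queries h"
proof (induction h)
  case (Cons y h)
  obtain q x where y: "y = (q, x)" by force
  have "probed (y # h) = probe q \<union> probed h"
    by (simp add: probed_def y)
  moreover have "card (probe q \<union> probed h) \<le> card (probe q) + card (probed h)"
    by (rule card_Un_le)
  ultimately show ?case
    using Cons by (cases q) (auto simp: num_queries_def y)
qed (simp add: probed_def)

lemma pair_in_clique: "{u, v} \<in> clique S \<Longrightarrow> u \<in> S"
  by (simp add: clique_def)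

text \<open>A vertex outside \<open>S\<close> is isolated in \<open>clique S\<close>, as every
  vertex is in the empty graph.\<close>

lemma answer_clique_eq_empty:
  assumes "probe q \<inter> S = {}"
  shows "answer_pmf n (clique S) h q = answer_pmf n {} h q"
proof (cases q)
  case (Degree u)
  with assms have "{e \<in> clique S. u \<in> e} = {}"
    by (auto simp: clique_def)
  then have "degree (clique S) u = degree {} u"
    by (simp only: degree_def) simp
  then show ?thesis by (simp add: Degree)
next
  case (Pair u v)
  with assms show ?thesis by (auto dest: pair_in_clique)
next
  case (Neighbor u)
  with assms show ?thesis by (auto simp: new_neighbors_def dest: pair_in_clique)
qed simp

lemma run_extends_transcript:
  "z \<in> set_pmf (run n E A m h) \<Longrightarrow> \<exists>g. fst z = h @ g"
proof (induction m arbitrary: h)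
  case (Suc m)
  from Suc.prems obtain a where
    "z \<in> set_pmf (case a of Output s \<Rightarrow> return_pmf (h, Some s)
      | Ask y \<Rightarrow> answer_pmf n E h y \<bind> (\<lambda>x. run n E A m (h @ [(y, x)])))"
    by auto
  then show ?case using Suc.IH by (cases a) fastforce+
qed simp

text \<open>A transcript records every query that led to it. Queries missing \<open>S\<close> have
  the same answer distribution in both graphs, and a query meeting \<open>S\<close> cannot occur on
  the way to \<open>z\<close>.\<close>

lemma pmf_run_clique_eq_empty:
  assumes "probed (fst z) \<inter> S = {}"
  shows "pmf (run n (clique S) A m h) z = pmf (run n {} A m h) z"
proof (induction m arbitrary: h)
  case (Suc m)
  have "pmf (answer_pmf n (clique S) h q \<bind> (\<lambda>x. run n (clique S) A m (h @ [(q, x)]))) z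
      = pmf (answer_pmf n {} h q \<bind> (\<lambda>x. run n {} A m (h @ [(q, x)]))) z" for q
  proof (cases "probe q \<inter> S = {}")
    case True
    then show ?thesis
      by (simp add: answer_clique_eq_empty pmf_bind Suc)
  next
    case False
    \<comment> \<open>Transcripts only grow, so after a query meeting \<open>S\<close> the result
      \<open>z\<close> is out of reach in either graph.\<close>
    have "pmf (answer_pmf n E h q \<bind> (\<lambda>x. run n E A m (h @ [(q, x)]))) z = 0" for E
    proof -
      have "z \<notin> set_pmf (run n E A m (h @ [(q, x)]))" for x
      proof
        assume "z \<in> set_pmf (run n E A m (h @ [(q, x)]))"
        from run_extends_transcript[OF this] have "(q, x) \<in> set (fst z)" by auto
        then have "probe q \<subseteq> probed (fst z)" by (force simp: probed_def)
        with False assms show False by blast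
      qed
      then show ?thesis by (auto simp: pmf_eq_0_set_pmf)
    qed
    then show ?thesis by simp
  qed
  then show ?case
    by (auto simp: pmf_bind intro!: Bochner_Integration.integral_cong split: action.splits)
qed simp

lemma prob_run_clique_eq_empty:
  assumes "\<And>z. z \<in> X \<Longrightarrow> probed (fst z) \<inter> S = {}"
  shows "measure_pmf.prob (run n (clique S) A m h) X = measure_pmf.prob (run n {} A m h) X"
  unfolding measure_pmf_conv_infsetsum
  by (intro infsetsum_cong) (auto simp: assms pmf_run_clique_eq_empty)

section \<open>Cyclic shifts of a clique and averaging over them\<close>

text \<open>The \<open>n\<close> rotations stand in for all labelings: for \<open>k \<le> n\<close>,
  each vertex below \<open>n\<close> lies in exactly \<open>k\<close> of them.\<close>

definition shifted_clique :: "nat \<Rightarrow> nat \<Rightarrow> nat \<Rightarrow> nat set" where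
  "shifted_clique n k j = (\<lambda>i. (i + j) mod n) ` {..<k}"

lemma shift_permutes:
  fixes n j :: nat
  shows "(\<lambda>i. if i < n then (i + j) mod n else i) permutes {..<n}"
proof (rule bij_imp_permutes)
  let ?f = "\<lambda>i. if i < n then (i + j) mod n else i"
  \<comment> \<open>The shift is undone over the integers, where subtracting \<open>j\<close> is not
    cut off at zero.\<close>
  have mod: "int z mod int n = (int ((z + j) mod n) - int j) mod int n" for z
    by (simp add: zmod_int mod_diff_left_eq)
  have "inj_on ?f {..<n}"
  proof (rule inj_onI)
    fix x y assume xy: "x \<in> {..<n}" "y \<in> {..<n}" "?f x = ?f y"
    then have "(x + j) mod n = (y + j) mod n" by (simp split: if_splits)
    then have "int x mod int n = int y mod int n" unfolding mod[of x] mod[of y] by (rule arg_cong)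
    then show "x = y" using xy(1,2) by simp
  qed
  moreover have "?f ` {..<n} \<subseteq> {..<n}"
    by auto
  ultimately show "bij_betw ?f {..<n} {..<n}"
    unfolding bij_betw_def using endo_inj_surj[OF finite_lessThan] by blast
qed simp

lemma image_clique:
  assumes "inj f"
  shows "(\<lambda>e. f ` e) ` clique S = clique (f ` S)"
proof -
  have "e \<in> (\<lambda>e. f ` e) ` clique S" if e: "e \<in> clique (f ` S)" for e
  proof -
    from e obtain d where "d \<subseteq> S" "e = f ` d"
      unfolding clique_def by (auto simp: subset_image_iff)
    moreover have "card e = card d"
      unfolding \<open>e = f ` d\<close> by (rule card_image) (meson assms inj_on_subset subset_UNIV)
    ultimately show ?thesis using e by (auto simp: clique_def)
  qed
  moreover have "card (f ` e) = card e" for e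
    by (rule card_image) (meson assms inj_on_subset subset_UNIV)
  ultimately show ?thesis by (auto simp: clique_def)
qed

lemma shifted_clique_copy:
  assumes "k \<le> n"
  shows "clique (shifted_clique n k j) \<in> copies n (clique {..<k})"
    and "shifted_clique n k j \<subseteq> {..<n}"
    and "card (shifted_clique n k j) = k"
proof -
  let ?f = "\<lambda>i. if i < n then (i + j) mod n else i"
  have eq: "shifted_clique n k j = ?f ` {..<k}"
    unfolding shifted_clique_def using assms by (intro image_cong) auto
  have p: "?f permutes {..<n}" by (rule shift_permutes)
  then have inj: "inj ?f" by (rule permutes_inj)
  show "clique (shifted_clique n k j) \<in> copies n (clique {..<k})"
    unfolding copies_def eq using image_clique[OF inj] p by blast
  show "shifted_clique n k j \<subseteq> {..<n}"
    unfolding eq using assms permutes_image[OF p] by (auto 0 3)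
  show "card (shifted_clique n k j) = k"
    unfolding eq using card_image[OF inj_on_subset[OF inj subset_UNIV]] by simp
qed

text \<open>In \<open>u = (i + j) mod n\<close> the position \<open>i\<close> of \<open>u\<close> in
  the clique determines the shift \<open>j\<close>, and there are only \<open>k\<close>
  positions.\<close>

lemma card_shifts_hitting_vertex:
  "card {j \<in> {..<n}. u \<in> shifted_clique n k j} \<le> k"
proof -
  have "{j \<in> {..<n}. u \<in> shifted_clique n k j} \<subseteq> (\<lambda>i. nat ((int u - int i) mod int n)) ` {..<k}"
  proof
    fix j assume "j \<in> {j \<in> {..<n}. u \<in> shifted_clique n k j}"
    then obtain i where i: "j < n" "i < k" "u = (i + j) mod n"
      by (auto simp: shifted_clique_def)
    have "(int u - int i) mod int n = int j mod int n"
      unfolding i(3) by (simp add: zmod_int mod_diff_left_eq)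
    also have "\<dots> = int j" using i by simp
    finally show "j \<in> (\<lambda>i. nat ((int u - int i) mod int n)) ` {..<k}"
      using i by force
  qed
  then have "card {j \<in> {..<n}. u \<in> shifted_clique n k j}
      \<le> card ((\<lambda>i. nat ((int u - int i) mod int n)) ` {..<k})"
    by (intro card_mono) auto
  also have "\<dots> \<le> k" using card_image_le[of "{..<k}"] by simp
  finally show ?thesis .
qed

text \<open>Union bound over the vertices of \<open>P\<close>. The difference is taken over the
  reals, where it may be negative.\<close>

lemma card_shifts_missing:
  assumes "finite P"
  shows "real n - real (card P) * real k
    \<le> real (card {j \<in> {..<n}. P \<inter> shifted_clique n k j = {}})"
proof -
  let ?H = "\<Union>u\<in>P. {j \<in> {..<n}. u \<in> shifted_clique n k j}"
  have eq: "{..<n} = {j \<in> {..<n}. P \<inter> shifted_clique n k j = {}} \<union> ?H" by auto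
  have "card ?H \<le> (\<Sum>u\<in>P. card {j \<in> {..<n}. u \<in> shifted_clique n k j})"
    by (rule card_UN_le[OF assms])
  also have "\<dots> \<le> card P * k"
    using sum_bounded_above[of P "\<lambda>u. card {j \<in> {..<n}. u \<in> shifted_clique n k j}" k]
      card_shifts_hitting_vertex by simp
  finally have "card ?H \<le> card P * k" .
  moreover have "n \<le> card {j \<in> {..<n}. P \<inter> shifted_clique n k j = {}} + card ?H"
    using card_Un_le[of "{j \<in> {..<n}. P \<inter> shifted_clique n k j = {}}" ?H]
    unfolding eq[symmetric] by simp
  ultimately have "n \<le> card {j \<in> {..<n}. P \<inter> shifted_clique n k j = {}} + card P * k" by linarith
  then have "real n \<le> real (card {j \<in> {..<n}. P \<inter> shifted_clique n k j = {}} + card P * k)"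
    by (rule of_nat_mono)
  then show ?thesis by simp
qed

text \<open>Double counting: each transcript on the empty graph probes at most \<open>q\<close>
  vertices, so at least \<open>n - q * k\<close> shifts miss it, and on each of these it has the
  same probability as on the empty graph.\<close>

lemma sum_prob_shifted_cliques_ge:
  assumes "\<And>z. z \<in> set_pmf (run n {} B m h) \<Longrightarrow> num_queries (fst z) \<le> q"
  shows "(real n - real q * real k) * measure_pmf.prob (run n {} B m h) X
    \<le> (\<Sum>j<n. measure_pmf.prob (run n (clique (shifted_clique n k j)) B m h) X)"
proof -
  let ?M = "run n {} B m h"
  \<comment> \<open>The part of \<open>X\<close> on which the runs on the empty graph and on shift
    \<open>j\<close> agree.\<close>
  let ?N = "\<lambda>j. {z \<in> X. probed (fst z) \<inter> shifted_clique n k j = {}}"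
  have int: "integrable (measure_pmf ?M) (indicat_real Y)" for Y
    by (rule integrable_real_indicator) (auto simp: measure_pmf.emeasure_eq_measure)
  have "(real n - real q * real k) * measure_pmf.prob ?M X
      = measure_pmf.expectation ?M (\<lambda>z. (real n - real q * real k) * indicator X z)"
    by simp
  also have "\<dots> \<le> measure_pmf.expectation ?M (\<lambda>z. \<Sum>j<n. indicator (?N j) z)"
  proof (rule integral_mono_AE)
    show "AE z in measure_pmf ?M. (real n - real q * real k) * indicator X z
        \<le> (\<Sum>j<n. indicator (?N j) z)"
    proof (rule AE_pmfI)
      fix z assume z: "z \<in> set_pmf ?M"
      have "(\<Sum>j<n. indicator (?N j) z) =
          real (card {j \<in> {..<n}. probed (fst z) \<inter> shifted_clique n k j = {}}) * indicator X z"
        by (auto simp: indicator_def sum.If_cases Int_def)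
      moreover have "real n - real q * real k
          \<le> real (card {j \<in> {..<n}. probed (fst z) \<inter> shifted_clique n k j = {}})"
      proof -
        have "real (card (probed (fst z))) * real k \<le> real q * real k"
          using card_probed_le[of "fst z"] assms[OF z] by (intro mult_right_mono) auto
        with card_shifts_missing[of "probed (fst z)" n k] card_probed_le[of "fst z"]
        show ?thesis by linarith
      qed
      ultimately show "(real n - real q * real k) * indicator X z \<le> (\<Sum>j<n. indicator (?N j) z)"
        by (simp add: indicator_def)
    qed
  qed (intro integrable_mult_right Bochner_Integration.integrable_sum int)+
  also have "\<dots> = (\<Sum>j<n. measure_pmf.prob ?M (?N j))"
    by (subst Bochner_Integration.integral_sum) (auto intro: int)
  also have "\<dots> = (\<Sum>j<n. measure_pmf.prob (run n (clique (shifted_clique n k j)) B m h) (?N j))"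
    by (intro sum.cong refl prob_run_clique_eq_empty[symmetric]) auto
  also have "\<dots> \<le> (\<Sum>j<n. measure_pmf.prob (run n (clique (shifted_clique n k j)) B m h) X)"
    by (intro sum_mono measure_pmf.finite_measure_mono) auto
  finally show ?thesis .
qed

section \<open>Stopping an algorithm after \<open>q\<close> charged queries\<close>

text \<open>The test precedes the query: up to \<open>q\<close> charged queries pass, the next one
  is replaced by the output \<open>r\<close>, and samples always pass.\<close>

definition truncate :: "nat \<Rightarrow> 'r \<Rightarrow> 'r algorithm \<Rightarrow> 'r algorithm" where
  "truncate q r A h = map_pmf (\<lambda>a. case a of
      Output s \<Rightarrow> Output s
    | Ask x \<Rightarrow> if x \<noteq> Sample \<and> q \<le> num_queries h then Output r else Ask x) (A h)"

lemma num_queries_append_single: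
  "num_queries (h @ [(y, x)]) = num_queries h + (if y = Sample then 0 else 1)"
  by (simp add: num_queries_def)

lemma num_queries_run_truncate:
  assumes "z \<in> set_pmf (run n E (truncate q r A) m h)" "num_queries h \<le> q"
  shows "num_queries (fst z) \<le> q"
  using assms
proof (induction m arbitrary: h)
  case (Suc m)
  from Suc.prems(1) obtain a where a: "a \<in> set_pmf (truncate q r A h)"
    and z: "z \<in> set_pmf (case a of Output s \<Rightarrow> return_pmf (h, Some s)
      | Ask y \<Rightarrow> answer_pmf n E h y \<bind> (\<lambda>x. run n E (truncate q r A) m (h @ [(y, x)])))"
    by auto
  show ?case
  proof (cases a)
    case (Ask y)
    then have "y = Sample \<or> num_queries h < q"
      using a by (auto simp: truncate_def split: action.splits if_splits)
    then have "num_queries (h @ [(y, x)]) \<le> q" for x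
      using Suc.prems(2) by (auto simp: num_queries_append_single)
    then show ?thesis using z Ask Suc.IH by auto
  next
    case (Output s)
    then show ?thesis using z Suc.prems(2) by simp
  qed
qed simp

lemma emeasure_run_Suc:
  "emeasure (measure_pmf (run n E A (Suc m) h)) X =
    (\<integral>\<^sup>+a. (case a of Output s \<Rightarrow> indicator X (h, Some s)
      | Ask y \<Rightarrow> \<integral>\<^sup>+x. emeasure (measure_pmf (run n E A m (h @ [(y, x)]))) X
          \<partial>measure_pmf (answer_pmf n E h y)) \<partial>measure_pmf (A h))"
  by (auto simp: emeasure_bind_pmf intro!: nn_integral_cong split: action.splits)

text \<open>Truncation is moved into the integrand, so that both algorithms become integrals over
  the same measure \<open>A h\<close> and can be compared action by action.\<close>

lemma emeasure_run_truncate_Suc: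
  "emeasure (measure_pmf (run n E (truncate q r A) (Suc m) h)) X =
    (\<integral>\<^sup>+a. (case a of Output s \<Rightarrow> indicator X (h, Some s)
      | Ask y \<Rightarrow> if y \<noteq> Sample \<and> q \<le> num_queries h then indicator X (h, Some r)
          else \<integral>\<^sup>+x. emeasure (measure_pmf (run n E (truncate q r A) m (h @ [(y, x)]))) X
          \<partial>measure_pmf (answer_pmf n E h y)) \<partial>measure_pmf (A h))"
  unfolding emeasure_run_Suc truncate_def[of q r A h]
  by (auto intro!: nn_integral_cong split: action.splits)

text \<open>A cut replaces a continuation, which succeeds with probability at most 1, by a certain
  output \<open>r\<close> in \<open>R\<close>.\<close>

lemma prob_run_le_truncate:
  assumes "r \<in> R"
  shows "emeasure (measure_pmf (run n E A m h)) {(h, x). x \<in> Some ` R}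
    \<le> emeasure (measure_pmf (run n E (truncate q r A) m h)) {(h, x). x \<in> Some ` R}"
proof (induction m arbitrary: h)
  case (Suc m)
  show ?case
    unfolding emeasure_run_Suc[of _ _ A] emeasure_run_truncate_Suc
  proof (intro nn_integral_mono, goal_cases)
    case (1 a)
    have "(\<integral>\<^sup>+x. emeasure (measure_pmf (run n E A m (h @ [(y, x)]))) {(h, x). x \<in> Some ` R}
          \<partial>measure_pmf (answer_pmf n E h y)) \<le> 1" for y
      using nn_integral_mono[of "measure_pmf (answer_pmf n E h y)" _ "\<lambda>_. 1"]
      by (simp add: measure_pmf.emeasure_le_1 measure_pmf.emeasure_space_1)
    then show ?case
      using assms Suc by (auto intro!: nn_integral_mono split: action.splits)
  qed
qed simp

text \<open>A cut occurs only where \<open>A\<close> itself would exceed \<open>q\<close> queries,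
  so every output caused by a cut, whatever \<open>r\<close> is, is charged to that event.\<close>

lemma prob_run_truncate_le:
  "emeasure (measure_pmf (run n E (truncate q r A) m h)) {(h, x). x \<in> Some ` R}
    \<le> emeasure (measure_pmf (run n E A m h)) {(h, x). x \<in> Some ` R \<or> q < num_queries h}"
proof (induction m arbitrary: h)
  case (Suc m)
  let ?X = "{(h :: transcript, x). x \<in> Some ` R \<or> q < num_queries h}"
  show ?case
    unfolding emeasure_run_Suc[of _ _ A] emeasure_run_truncate_Suc
  proof (intro nn_integral_mono, goal_cases)
    case (1 a)
    \<comment> \<open>With the budget used up, this query brings the count above \<open>q\<close>,
      and it stays there in every extension of the transcript.\<close>
    have "(\<integral>\<^sup>+x. emeasure (measure_pmf (run n E A m (h @ [(y, x)]))) ?X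
          \<partial>measure_pmf (answer_pmf n E h y)) = 1"
      if y: "y \<noteq> Sample" "q \<le> num_queries h" for y
    proof -
      have "emeasure (measure_pmf (run n E A m (h @ [(y, x)]))) ?X = 1" for x
      proof (rule measure_pmf.emeasure_eq_1_AE)
        show "AE z in measure_pmf (run n E A m (h @ [(y, x)])). z \<in> ?X"
        proof (rule AE_pmfI)
          fix z assume "z \<in> set_pmf (run n E A m (h @ [(y, x)]))"
          from run_extends_transcript[OF this] obtain g where "fst z = (h @ [(y, x)]) @ g" by blast
          then show "z \<in> ?X" using y by (cases z) (auto simp: num_queries_def)
        qed
      qed simp
      then show ?thesis by (simp add: measure_pmf.emeasure_space_1)
    qed
    then show ?case
      using Suc by (auto intro!: nn_integral_mono simp: indicator_def split: action.splits)
  qed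
qed simp

section \<open>Output probabilities and Markov's inequality\<close>

lemma prob_run_Suc_ge:
  "emeasure (measure_pmf (run n E A m h)) {(h, x). x \<in> Some ` R}
    \<le> emeasure (measure_pmf (run n E A (Suc m) h)) {(h, x). x \<in> Some ` R}"
proof (induction m arbitrary: h)
  case (Suc m)
  show ?case
    unfolding emeasure_run_Suc[of n E A "Suc m" h] emeasure_run_Suc[of n E A m h]
    using Suc by (auto intro!: nn_integral_mono simp del: run.simps split: action.splits)
qed simp

lemma mono_prob_run:
  "mono (\<lambda>m. measure_pmf.prob (run n E A m h) {(h, x). x \<in> Some ` R})"
  using prob_run_Suc_ge[of n E A _ h R]
  by (intro incseq_SucI) (simp add: measure_pmf.emeasure_eq_measure del: run.simps)

lemma prob_run_le_output_prob:
  "measure_pmf.prob (run n E A m []) {(h, x). x \<in> Some ` R} \<le> output_prob n E A R"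
  unfolding output_prob_def
  by (rule cSUP_upper) (auto intro!: bdd_aboveI[of _ 1])

text \<open>The two suprema range over separate step bounds. By monotonicity both can be raised to
  the larger one, where the events are disjoint in a single distribution.\<close>

lemma output_prob_disjoint:
  assumes "R \<inter> R' = {}"
  shows "output_prob n E A R + output_prob n E A R' \<le> 1"
proof -
  let ?P = "\<lambda>R m. measure_pmf.prob (run n E A m []) {(h, x). x \<in> Some ` R}"
  have *: "?P R m + ?P R' m' \<le> 1" for m m'
  proof -
    let ?l = "max m m'"
    have "?P R m + ?P R' m' \<le> ?P R ?l + ?P R' ?l"
      by (intro add_mono monoD[OF mono_prob_run]) auto
    also have "\<dots> = measure_pmf.prob (run n E A ?l [])
        ({(h, x). x \<in> Some ` R} \<union> {(h, x). x \<in> Some ` R'})"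
      using assms by (intro measure_pmf.finite_measure_Union[symmetric]) auto
    also have "\<dots> \<le> 1" by simp
    finally show ?thesis .
  qed
  have "output_prob n E A R \<le> 1 - ?P R' m'" for m'
    unfolding output_prob_def using *[of _ m']
    by (intro cSUP_least) (auto simp: algebra_simps)
  then have "?P R' m' \<le> 1 - output_prob n E A R" for m'
    by (simp add: algebra_simps)
  then have "output_prob n E A R' \<le> 1 - output_prob n E A R"
    unfolding output_prob_def[of n E A R'] by (intro cSUP_least) auto
  then show ?thesis by simp
qed

text \<open>Markov's inequality for the first \<open>m\<close> steps, with a bound independent of
  \<open>m\<close>.\<close>

lemma prob_many_queries_le:
  assumes "expected_queries n E A < ennreal M" "0 < x"
  shows "measure_pmf.prob (run n E A m []) {z. x \<le> real (num_queries (fst z))} \<le> M / x"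
proof -
  let ?M = "measure_pmf (run n E A m [])"
  \<comment> \<open>\<open>ennreal M\<close> is 0 for \<open>M \<le> 0\<close>, and nothing lies
    strictly below 0.\<close>
  have M: "0 < M" using assms(1) by (metis ennreal_eq_0_iff linorder_not_less not_less_zero)
  have "ennreal x * emeasure ?M {z. x \<le> real (num_queries (fst z))}
      = (\<integral>\<^sup>+z. ennreal x * indicator {z. x \<le> real (num_queries (fst z))} z \<partial>?M)"
    by (simp add: nn_integral_cmult)
  also have "\<dots> \<le> (\<integral>\<^sup>+z. of_nat (num_queries (fst z)) \<partial>?M)"
    by (intro nn_integral_mono)
      (auto simp: indicator_def ennreal_of_nat_eq_real_of_nat intro!: ennreal_leI)
  also have "\<dots> \<le> expected_queries n E A"
    unfolding expected_queries_def by (rule SUP_upper) simp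
  also have "\<dots> \<le> ennreal M" using assms(1) by simp
  finally have "x * measure_pmf.prob (run n E A m []) {z. x \<le> real (num_queries (fst z))} \<le> M"
    using M assms(2) by (simp add: measure_pmf.emeasure_eq_measure ennreal_mult[symmetric])
  then show ?thesis using assms(2) by (simp add: field_simps)
qed

section \<open>The query lower bound for hidden cliques\<close>

text \<open>\<open>R0\<close> and \<open>R1\<close> are the outputs accepted on the empty graph and
  on the clique, which serves both approximation and distinguishing. Otherwise \<open>R0\<close> has
  probability at most \<open>1 - p + \<delta>\<close> on every shift after truncation, hence at most
  \<open>1 - p + 2 * \<delta>\<close> on the empty graph, which is below \<open>p\<close>.\<close>

lemma clique_query_lower_bound:
  fixes A :: "'r algorithm"
  assumes kn: "0 < k" "k \<le> n" and p: "1/2 < p" and R: "R0 \<inter> R1 = {}"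
    and P0: "p \<le> output_prob n {} A R0"
    and P1: "\<And>j. j < n \<Longrightarrow> p \<le> output_prob n (clique (shifted_clique n k j)) A R1"
  shows "\<exists>j<n. ennreal (((2 * p - 1) / 3)\<^sup>2 * real n / real k)
    \<le> expected_queries n (clique (shifted_clique n k j)) A"
proof (rule ccontr)
  \<comment> \<open>The gap \<open>2 * p - 1\<close> is \<open>3 * \<delta>\<close>: one
    \<open>\<delta>\<close> pays for Markov's inequality, one for the shifts that are hit, and the
    third leaves the contradiction.\<close>
  define \<delta> where "\<delta> = (2 * p - 1) / 3"
  \<comment> \<open>At this threshold, an expectation below
    \<open>\<delta>\<^sup>2 * real n / real k\<close> makes Markov's bound exactly
    \<open>\<delta>\<close>.\<close>
  define x where "x = \<delta> * real n / real k"
  define q where "q = nat \<lfloor>x\<rfloor>"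
  let ?K = "\<lambda>j. clique (shifted_clique n k j)"
  let ?O = "{(h :: transcript, x). x \<in> Some ` R0}"
  assume "\<not> ?thesis"
  then have less: "expected_queries n (?K j) A < ennreal (\<delta>\<^sup>2 * real n / real k)" if "j < n" for j
    using that by (auto simp: \<delta>_def not_le)
  have \<delta>: "0 < \<delta>" using p by (simp add: \<delta>_def)
  have n: "0 < n" using kn by simp
  have x: "0 < x" using \<delta> n kn by (simp add: x_def)
  \<comment> \<open>The first inequality bounds the shifts hit; the second turns more than
    \<open>q\<close> queries into at least \<open>x\<close>, as Markov's inequality
    requires.\<close>
  have q: "real q \<le> x" "x < real q + 1"
    using x by (simp_all add: q_def)
  \<comment> \<open>Truncation needs a default answer from \<open>R0\<close>.\<close>
  have "R0 \<noteq> {}"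
  proof
    assume "R0 = {}"
    then have "output_prob n {} A R0 = 0" by (simp add: output_prob_def)
    with P0 p show False by simp
  qed
  then obtain r where r: "r \<in> R0" by blast
  define B where "B = truncate q r A"
  have shifted: "measure_pmf.prob (run n (?K j) B m []) ?O \<le> 1 - p + \<delta>" if j: "j < n" for j m
  proof -
    let ?M = "run n (?K j) A m []"
    have "measure_pmf.prob (run n (?K j) B m []) ?O
        \<le> measure_pmf.prob ?M {(h, x). x \<in> Some ` R0 \<or> q < num_queries h}"
      using prob_run_truncate_le[of n "?K j" q r A m "[]" R0]
      by (simp add: B_def measure_pmf.emeasure_eq_measure)
    also have "\<dots> \<le> measure_pmf.prob ?M (?O \<union> {z. x \<le> real (num_queries (fst z))})"
      using q by (intro measure_pmf.finite_measure_mono) auto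
    also have "\<dots> \<le> measure_pmf.prob ?M ?O + measure_pmf.prob ?M {z. x \<le> real (num_queries (fst z))}"
      by (rule measure_Un_le) auto
    also have "measure_pmf.prob ?M ?O \<le> output_prob n (?K j) A R0"
      by (rule prob_run_le_output_prob)
    also have "output_prob n (?K j) A R0 \<le> 1 - p"
      using output_prob_disjoint[OF R, of n "?K j" A] P1[OF j] by simp
    also have "measure_pmf.prob ?M {z. x \<le> real (num_queries (fst z))}
        \<le> (\<delta>\<^sup>2 * real n / real k) / x"
      by (rule prob_many_queries_le[OF less[OF j] x])
    also have "\<dots> = \<delta>" using \<delta> n kn by (simp add: x_def power2_eq_square)
    finally show ?thesis by simp
  qed
  have qk: "real q * real k \<le> \<delta> * real n"
    using q(1) kn by (simp add: x_def field_simps)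
  have "measure_pmf.prob (run n {} A m []) ?O \<le> 1 - p + 2 * \<delta>" for m
  proof -
    let ?P = "measure_pmf.prob (run n {} B m []) ?O"
    have le: "measure_pmf.prob (run n {} A m []) ?O \<le> ?P"
      using prob_run_le_truncate[OF r, of n "{}" A m "[]" q]
      by (simp add: B_def measure_pmf.emeasure_eq_measure)
    have "(real n - real q * real k) * ?P \<le> (\<Sum>j<n. measure_pmf.prob (run n (?K j) B m []) ?O)"
      using num_queries_run_truncate[of _ n "{}" q r A m "[]"]
      by (intro sum_prob_shifted_cliques_ge) (simp add: B_def num_queries_def)
    also have "\<dots> \<le> real n * (1 - p + \<delta>)"
      using sum_bounded_above[of "{..<n}" "\<lambda>j. measure_pmf.prob (run n (?K j) B m []) ?O" "1 - p + \<delta>"]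
        shifted by simp
    \<comment> \<open>The term \<open>real q * real k * ?P\<close> goes to the right and is bounded
      by \<open>?P \<le> 1\<close>, which avoids dividing by
      \<open>real n - real q * real k\<close>.\<close>
    finally have "real n * ?P \<le> real n * (1 - p + \<delta>) + real q * real k * ?P"
      by (simp add: algebra_simps)
    also have "real q * real k * ?P \<le> \<delta> * real n * 1"
      by (rule mult_mono[OF qk measure_pmf.prob_le_1]) (use \<delta> in auto)
    finally have "real n * ?P \<le> real n * (1 - p + 2 * \<delta>)"
      by (simp add: algebra_simps)
    then have "?P \<le> 1 - p + 2 * \<delta>" using n by simp
    with le show ?thesis by simp
  qed
  then have "output_prob n {} A R0 \<le> 1 - p + 2 * \<delta>"
    unfolding output_prob_def by (intro cSUP_least) auto
  moreover have "2 * p - 1 = 3 * \<delta>" by (simp add: \<delta>_def)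
  ultimately show False using P0 \<delta> by linarith
qed

section \<open>Triangle counts and the choice of \<open>k\<close>\<close>

lemma num_triangles_clique:
  assumes "finite S"
  shows "num_triangles (clique S) = card S choose 3"
proof -
  have "(card T = 3 \<and> (\<forall>u\<in>T. \<forall>v\<in>T. u \<noteq> v \<longrightarrow> {u, v} \<in> clique S)) \<longleftrightarrow> T \<subseteq> S \<and> card T = 3" for T
  proof (intro iffI conjI subsetI)
    fix u assume T: "card T = 3 \<and> (\<forall>u\<in>T. \<forall>v\<in>T. u \<noteq> v \<longrightarrow> {u, v} \<in> clique S)" and u: "u \<in> T"
    \<comment> \<open>\<open>num_triangles\<close> does not confine \<open>T\<close> to a vertex
      set; \<open>u\<close> lies in \<open>S\<close> because it has an edge to a second vertex of
      \<open>T\<close>.\<close>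
    have "T \<noteq> {u}" using T by auto
    then obtain v where "v \<in> T" "v \<noteq> u" using u by blast
    then show "u \<in> S" using T u pair_in_clique by metis
  qed (auto simp: clique_def)
  then show ?thesis
    unfolding num_triangles_def using n_subsets[OF assms] by simp
qed

lemma num_triangles_empty: "num_triangles {} = 0"
proof -
  have "clique {} = {}" by (auto simp: clique_def)
  then show ?thesis using num_triangles_clique[of "{}"] by simp
qed

lemma simple_graph_clique: "S \<subseteq> {..<n} \<Longrightarrow> simple_graph n (clique S)"
  by (auto simp: simple_graph_def clique_def)

lemma real_choose_3:
  assumes "3 \<le> k"
  shows "real (k choose 3) = real k * (real k - 1) * (real k - 2) / 6"
proof -
  obtain i where "k = i + 3" using assms by (metis add.commute le_Suc_ex)
  then show ?thesis
    by (simp add: binomial_gbinomial gbinomial_prod_rev numeral_3_eq_3 fact_numeral field_simps)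
qed

lemma cube_le_choose_3:
  assumes "3 \<le> k"
  shows "real k ^ 3 \<le> 27 * real (k choose 3)"
proof -
  have k: "3 \<le> real k" using assms by simp
  \<comment> \<open>This product is twice the difference of the two sides; the constant 27 is
    attained at \<open>k = 3\<close>.\<close>
  have "0 \<le> real k * ((real k - 3) * (7 * real k - 6))"
    using k by (intro mult_nonneg_nonneg) auto
  then show ?thesis
    unfolding real_choose_3[OF assms] by (simp add: field_simps power3_eq_cube)
qed

text \<open>Take the largest \<open>k\<close> whose binomial does not exceed \<open>t\<close>.
  Consecutive binomials have ratio \<open>(k + 1) / (k - 2)\<close>, which is at most 4 from
  \<open>k = 3\<close> on.\<close>

lemma choose_3_approx:
  assumes "1 \<le> t" "t \<le> n choose 3"
  obtains k where "3 \<le> k" "k \<le> n" "k choose 3 \<le> t" "t \<le> 4 * (k choose 3)"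
proof -
  let ?K = "{k. k \<le> n \<and> k choose 3 \<le> t}"
  have n: "3 \<le> n" using assms by (metis binomial_eq_0 not_le not_one_le_zero order.trans)
  have fin: "finite ?K" by simp
  have "3 \<in> ?K" using n assms by simp
  then have k: "Max ?K \<in> ?K" "3 \<le> Max ?K"
    using Max_in[OF fin] Max_ge[OF fin] by blast+
  define k where "k = Max ?K"
  have "t \<le> 4 * (k choose 3)"
  proof (cases "k = n")
    case True
    then show ?thesis using assms by simp
  next
    case False
    then have "Suc k \<le> n" using k(1) by (simp add: k_def)
    moreover have "Suc k \<notin> ?K"
      using Max_ge[OF fin, of "Suc k"] unfolding k_def[symmetric] by (meson not_less_eq_eq order.refl)
    ultimately have "t \<le> Suc k choose 3" by simp
    moreover have "real (Suc k choose 3) \<le> 4 * real (k choose 3)"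
    proof -
      have k3: "3 \<le> real k" "3 \<le> k" using k(2) by (simp_all add: k_def)
      \<comment> \<open>Six times the difference of the two sides.\<close>
      have "0 \<le> real k * (real k - 1) * (3 * real k - 9)"
        using k3 by (intro mult_nonneg_nonneg) auto
      then show ?thesis
        using k3 by (simp add: real_choose_3 field_simps)
    qed
    ultimately show ?thesis by linarith
  qed
  then show ?thesis using that k by (auto simp: k_def)
qed

section \<open>Both forms of the lower bound\<close>

theorem theoremn:
  fixes C p :: real
  assumes "C \<ge> 1" and "1/2 < p" and "p \<le> 1"
  shows "\<exists>a b c :: real. a > 0 \<and> b > 0 \<and> c > 0 \<and>
    (\<forall>n t :: nat. 1 \<le> t \<and> t \<le> n choose 3 \<longrightarrow>
      (\<forall>A. approximates_triangles n C p A \<longrightarrow>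
        (\<exists>E. simple_graph n E \<and>
             a * real t \<le> real (num_triangles E) \<and> real (num_triangles E) \<le> b * real t \<and>
             expected_queries n E A \<ge> ennreal (c * real n / root 3 (real (num_triangles E))))) \<and>
      (\<exists>E0 E1. simple_graph n E0 \<and> simple_graph n E1 \<and> num_triangles E0 = 0 \<and>
             a * real t \<le> real (num_triangles E1) \<and> real (num_triangles E1) \<le> b * real t \<and>
             (\<forall>A. (\<forall>E \<in> copies n E0 \<union> copies n E1.
                     expected_queries n E A < ennreal (c * real n / root 3 (real t)))
                \<longrightarrow> \<not> distinguishes n p A E0 E1)))"
\<comment> \<open>\<open>1/4\<close> and \<open>1\<close> come from \<open>choose_3_approx\<close>.
  The last constant is the one for \<open>n / k\<close>, divided by 3 because \<open>k\<close> is at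
  most three times the cube root of its triangle count.\<close>
proof (rule exI[of _ "1/4"], rule exI[of _ 1], rule exI[of _ "((2 * p - 1) / 3)\<^sup>2 / 3"],
    intro conjI, goal_cases)
  case 3
  then show ?case using assms by simp
next
  case 4
  show ?case
  proof (intro allI impI, goal_cases)
    case (1 n t)
    define c where "c = ((2 * p - 1) / 3)\<^sup>2"
    have c: "0 \<le> c" by (simp add: c_def)
    from 1 obtain k where k: "3 \<le> k" "k \<le> n" "k choose 3 \<le> t" "t \<le> 4 * (k choose 3)"
      using choose_3_approx by blast
    let ?K = "\<lambda>j. clique (shifted_clique n k j)"
    have kn: "0 < k" using k by simp
    have tri: "num_triangles (?K j) = k choose 3" for j
      using num_triangles_clique[OF finite_subset[OF shifted_clique_copy(2)[OF k(2)] finite_lessThan]]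
        shifted_clique_copy(3)[OF k(2)] by simp
    have "real k = root 3 (real k ^ 3)" by (simp add: real_root_power_cancel)
    also have "\<dots> \<le> root 3 (3 ^ 3 * real (k choose 3))"
      using cube_le_choose_3[OF k(1)] by (intro real_root_le_mono) auto
    also have "\<dots> = 3 * root 3 (real (k choose 3))"
      by (simp only: real_root_mult) (simp add: real_root_power_cancel del: power_numeral)
    finally have root: "real k \<le> 3 * root 3 (real (k choose 3))" .
    \<comment> \<open>Used with \<open>s = k choose 3\<close> for approximation and with
      \<open>s = t\<close> for distinguishing.\<close>
    have bound: "c / 3 * real n / root 3 (real s) \<le> c * real n / real k" if "k choose 3 \<le> s" for s
    proof -
      have "root 3 (real (k choose 3)) \<le> root 3 (real s)"
        using that by (intro real_root_le_mono) auto
      with root have "real k \<le> 3 * root 3 (real s)" by linarith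
      moreover from this have "0 < root 3 (real s)" using kn by linarith
      ultimately have "c * real n / (3 * root 3 (real s)) \<le> c * real n / real k"
        using kn c by (intro divide_left_mono) auto
      then show ?thesis by simp
    qed
    show ?case
    proof (intro conjI allI impI, goal_cases)
      case (1 A)
      let ?I = "{real (k choose 3) / C..C * real (k choose 3)}"
      have T: "0 < real (k choose 3)" using k by simp
      \<comment> \<open>On the empty graph only the estimate 0 is acceptable, and a positive lower
        end excludes it on the clique, whatever the factor \<open>C\<close>.\<close>
      have "0 < real (k choose 3) / C" using T assms by (intro divide_pos_pos) auto
      then have disj: "{0} \<inter> ?I = {}" by auto
      have "p \<le> output_prob n {} A {0}"
        using 1[unfolded approximates_triangles_def, rule_format, of "{}"]
        by (simp add: num_triangles_empty simple_graph_def)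
      moreover have "p \<le> output_prob n (?K j) A ?I" for j
        using 1[unfolded approximates_triangles_def, rule_format,
            OF simple_graph_clique[OF shifted_clique_copy(2)[OF k(2)]]]
        by (simp add: tri)
      ultimately obtain j where "ennreal (c * real n / real k) \<le> expected_queries n (?K j) A"
        using clique_query_lower_bound[OF kn k(2) assms(2) disj, of A] by (auto simp: c_def)
      then have "ennreal (c / 3 * real n / root 3 (real (num_triangles (?K j))))
          \<le> expected_queries n (?K j) A"
        using ennreal_leI[OF bound[OF order.refl]] tri by (metis order.trans)
      then show ?case
        using k(3,4) simple_graph_clique[OF shifted_clique_copy(2)[OF k(2)]]
        by (intro exI[of _ "?K j"]) (simp add: tri c_def)
    next
      case 2
      \<comment> \<open>Every shift is a copy of \<open>clique {..<k}\<close>, so both the success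
        guarantee and the assumed query bound apply to the shift that requires many queries.\<close>
      have "\<not> distinguishes n p A {} (clique {..<k})"
        if less: "\<forall>E \<in> copies n {} \<union> copies n (clique {..<k}).
          expected_queries n E A < ennreal (c / 3 * real n / root 3 (real t))" for A
      proof
        assume D: "distinguishes n p A {} (clique {..<k})"
        have "{} \<in> copies n {}" by (auto simp: copies_def intro: permutes_id)
        with D have "p \<le> output_prob n {} A {False}" by (simp add: distinguishes_def)
        moreover have "p \<le> output_prob n (?K j) A {True}" for j
          using D shifted_clique_copy(1)[OF k(2)] by (simp add: distinguishes_def)
        ultimately obtain j where "ennreal (c * real n / real k) \<le> expected_queries n (?K j) A"
          using clique_query_lower_bound[OF kn k(2) assms(2), of "{False}" "{True}" A]
          by (auto simp: c_def)
        moreover have "expected_queries n (?K j) A < ennreal (c / 3 * real n / root 3 (real t))"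
          using less shifted_clique_copy(1)[OF k(2)] by blast
        ultimately show False
          using ennreal_leI[OF bound[OF k(3)]] by (meson leD order.trans)
      qed
      moreover have "num_triangles (clique {..<k}) = k choose 3"
        using num_triangles_clique[of "{..<k}"] by simp
      ultimately show ?case
        using k(2-4) by (intro exI[of _ "{}"] exI[of _ "clique {..<k}"])
          (auto simp: num_triangles_empty simple_graph_def c_def clique_def)
    qed
  qed
qed simp_all

end
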